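(* Let $n\ge 3$ and let $\Delta_\Gamma(Y_{3,n})$ be the Gallai-simplicial complex of the prism graph $Y_{3,n}$ with $3n$ vertices. Let $N=\dim\Delta_\Gamma(Y_{3,n})$ and let $f_k$ be the number of $k$-dimensional faces of $\Delta_\Gamma(Y_{3,n})$. Then the Euler characteristic of $\Delta_\Gamma(Y_{3,n})$ is $$\chi(\Delta_\Gamma(Y_{3,n}))=\sum_{k=0}^N(-1)^k f_k=3(n-1).$$
   Context: Prism graph: $Y_{3,n}=C_3\times P_n$ is the Cartesian product of the cycle $C_3$ and the path graph $P_n$ on $n$ vertices; it has $3n$ vertices and $3(2n-1)$ edges. Writing $e_{i,j}=\{i,j\}$, it is labelled so that its vertex set is $[3n]=\{1,\dots,3n\}$ and its edge set consists of $e_{3i+1,3i+2},\ e_{3i+2,3i+3},\ e_{3i+3,3i+1}$ for $0\le i\le n-1$ (the $n$ copies of $C_3$), together with $e_{j,j+3}$ for $1\le j\le 3n-3$. Gallai graph: for a graph $G$, the Gallai graph $\Gamma(G)$ has vertex set $E(G)$, and two distinct edges of $G$ are adjacent in $\Gamma(G)$ if and only if they share an endpoint in $G$ and do not span a triangle in $G$ (i.e. $e_{i,j}$ and $e_{j,k}$ with $i\ne k$ are adjacent in $\Gamma(G)$ iff $\{i,k\}\notin E(G)$). Gallai-indices: for a finite simple graph $G$ with $V(G)=[m]$, the set $\Omega(G)$ of Gallai-indices is the collection of subsets of $V(G)$ consisting of the sets $F_{i,j,k}=\{i,j,k\}$ for all pairs $e_{i,j},e_{j,k}$ adjacent in $\Gamma(G)$,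 and the sets $F_{i,j}=\{i,j\}$ for all $e_{i,j}$ that are isolated vertices of $\Gamma(G)$. Gallai-simplicial complex: $\Delta_\Gamma(G)=\langle F \mid F\in\Omega(G)\rangle$ is the simplicial complex on $V(G)$ generated by $\Omega(G)$; its faces are the subsets of elements of $\Omega(G)$. A face $F$ has dimension $|F|-1$ (the empty face, of dimension $-1$, is not counted in the Euler characteristic). *)

theory Defs imports Main begin

record 'a ugraph =
  verts :: "'a set"
  edges :: "'a set set"

definition simple_graph :: "'a ugraph \<Rightarrow> bool" where
  "simple_graph G \<longleftrightarrow> finite (verts G) \<and> (\<forall>e \<in> edges G. e \<subseteq> verts G \<and> card e = 2)"

definition isolated_vertex :: "'a ugraph \<Rightarrow> 'a \<Rightarrow> bool" where
  "isolated_vertex G v \<longleftrightarrow> v \<in> verts G \<and> (\<forall>w. {v, w} \<notin> edges G)"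

text \<open>The labelling of \<open>C\<^sub>3 \<times> P\<^sub>n\<close> on \<open>{1, \<dots>, 3n}\<close>: the \<open>i\<close>-th triangle occupies
  \<open>3i+1, 3i+2, 3i+3\<close>, and the edges \<open>{j, j+3}\<close> join consecutive triangles.\<close>

definition prism_graph :: "nat \<Rightarrow> nat ugraph" where
  "prism_graph n = \<lparr>
     verts = {1..3*n},
     edges = (\<Union>i<n. {{3*i+1, 3*i+2}, {3*i+2, 3*i+3}, {3*i+3, 3*i+1}})
             \<union> {{j, j+3} | j. 1 \<le> j \<and> j \<le> 3*n - 3} \<rparr>"

lemma simple_graph_prism_graph: "simple_graph (prism_graph n)"
  by (auto simp: simple_graph_def prism_graph_def)

text \<open>For a simple graph the condition \<open>i \<noteq> k\<close> makes the two edges distinct.\<close>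

definition gallai_graph :: "'a ugraph \<Rightarrow> 'a set ugraph" where
  "gallai_graph G = \<lparr>
     verts = edges G,
     edges = {{{i, j}, {j, k}} | i j k.
       {i, j} \<in> edges G \<and> {j, k} \<in> edges G \<and> i \<noteq> k \<and> {i, k} \<notin> edges G} \<rparr>"

definition gallai_indices :: "'a ugraph \<Rightarrow> 'a set set" where
  "gallai_indices G =
     {{i, j, k} | i j k. {{i, j}, {j, k}} \<in> edges (gallai_graph G)}
     \<union> {{i, j} | i j. isolated_vertex (gallai_graph G) {i, j}}"

definition generated_complex :: "'a set set \<Rightarrow> 'a set set" where
  "generated_complex S = {F. \<exists>A \<in> S. F \<subseteq> A}"

definition gallai_complex :: "'a ugraph \<Rightarrow> 'a set set" where
  "gallai_complex G = generated_complex (gallai_indices G)"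

text \<open>Dimensions are integers, so that the empty face has dimension \<open>-1\<close>; it is thereby
  excluded from the Euler characteristic, whose index starts at \<open>0\<close>.\<close>

definition face_dim :: "'a set \<Rightarrow> int" where
  "face_dim F = int (card F) - 1"

definition complex_dim :: "'a set set \<Rightarrow> int" where
  "complex_dim \<Delta> = Max (face_dim ` \<Delta>)"

definition face_count :: "'a set set \<Rightarrow> int \<Rightarrow> nat" where
  "face_count \<Delta> k = card {F \<in> \<Delta>. face_dim F = k}"

definition euler_characteristic :: "'a set set \<Rightarrow> int" where
  "euler_characteristic \<Delta> =
     (\<Sum>k = 0..complex_dim \<Delta>. (- 1) ^ nat k * int (face_count \<Delta> k))"

end

theory Submission imports Defs begin

text \<open>Every nonempty face meets at most three consecutive triangles of the prism, so it is a
  translate of exactly one base face whose lowest layer is the triangle \<open>{1, 2, 3}\<close>. A base face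
  spanning \<open>k\<close> layers has \<open>n + 1 - k\<close> translates. The alternating count of base faces is
  \<open>3 - 3 = 0\<close> for one layer, \<open>-9 + 12 = 3\<close> for two layers and \<open>-3 + 3 = 0\<close> for three, so only
  the two-layer faces contribute, giving \<open>3(n - 1)\<close>.\<close>

section \<open>The Euler characteristic as a signed sum over nonempty faces\<close>

lemma euler_characteristic_eq_sum:
  assumes fin: "finite \<Delta>" and faces: "\<And>F. F \<in> \<Delta> \<Longrightarrow> finite F"
  shows "euler_characteristic \<Delta> = (\<Sum>F \<in> \<Delta> - {{}}. (- 1) ^ (card F - 1))"
proof -
  let ?D = "\<lambda>k. {F \<in> \<Delta>. face_dim F = k}"
  \<comment> \<open>Grouping the faces by dimension loses none of them: finiteness of
    \<open>\<Delta>\<close> makes \<open>Max\<close> a genuine upper bound, and a nonempty finite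
    face has dimension at least 0.\<close>
  have dim: "face_dim F \<in> {0..complex_dim \<Delta>}" if "F \<in> \<Delta> - {{}}" for F
  proof -
    have "face_dim F \<le> complex_dim \<Delta>"
      unfolding complex_dim_def using that fin by auto
    moreover have "card F > 0"
      using that faces by (auto simp: card_gt_0_iff)
    ultimately show ?thesis by (simp add: face_dim_def)
  qed
  have "(\<Sum>F \<in> \<Delta> - {{}}. (- 1 :: int) ^ (card F - 1)) =
      (\<Sum>k = 0..complex_dim \<Delta>. \<Sum>F \<in> {F \<in> \<Delta> - {{}}. face_dim F = k}. (- 1) ^ (card F - 1))"
    using dim fin by (intro sum.group[symmetric]) blast+
  also have "\<dots> = (\<Sum>k = 0..complex_dim \<Delta>. (- 1) ^ nat k * int (face_count \<Delta> k))"
  proof (rule sum.cong[OF refl])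
    fix k assume k: "k \<in> {0..complex_dim \<Delta>}"
    \<comment> \<open>The empty face has dimension -1, so discarding it changes no level
      \<open>k \<ge> 0\<close>.\<close>
    then have "{F \<in> \<Delta> - {{}}. face_dim F = k} = ?D k"
      by (auto simp: face_dim_def)
    moreover have "(\<Sum>F \<in> ?D k. (- 1 :: int) ^ (card F - 1)) = (\<Sum>F \<in> ?D k. (- 1) ^ nat k)"
      by (rule sum.cong) (auto simp: face_dim_def nat_diff_distrib')
    ultimately show "(\<Sum>F \<in> {F \<in> \<Delta> - {{}}. face_dim F = k}. (- 1 :: int) ^ (card F - 1)) =
        (- 1) ^ nat k * int (face_count \<Delta> k)"
      by (simp add: face_count_def)
  qed
  finally show ?thesis by (simp add: euler_characteristic_def)
qed

section \<open>Layer and column coordinates on the prism\<close>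

definition columns :: "nat set" where
  "columns = {1, 2, 3}"

text \<open>Layers \<open>a\<close> are counted from 0 and columns \<open>p\<close> from 1, so that
  the labels start at 1 and each layer is one of the given triangles.\<close>

definition vertex :: "nat \<Rightarrow> nat \<Rightarrow> nat" where
  "vertex a p = 3 * a + p"

lemma vertex_eq_iff:
  assumes "p \<in> columns" "q \<in> columns"
  shows "vertex a p = vertex b q \<longleftrightarrow> a = b \<and> p = q"
  using assms unfolding columns_def vertex_def by (elim insertE emptyE; simp; presburger)

text \<open>This turns the labelled edge set into adjacency in a Cartesian product: vertices differ
  in exactly one coordinate. Any two columns of \<open>C_3\<close> are adjacent, while layers must
  be consecutive. From here on only coordinates matter.\<close>

lemma prism_edge_iff:
  assumes a: "a < n" "b < n" and p: "p \<in> columns" "q \<in> columns"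
  shows "{vertex a p, vertex b q} \<in> edges (prism_graph n) \<longleftrightarrow>
    a = b \<and> p \<noteq> q \<or> p = q \<and> (b = Suc a \<or> a = Suc b)"
proof -
  let ?e = "{vertex a p, vertex b q}"
  have tri: "(\<exists>i<n. ?e \<in> {{3*i+1, 3*i+2}, {3*i+2, 3*i+3}, {3*i+3, 3*i+1}}) \<longleftrightarrow> a = b \<and> p \<noteq> q"
    (is "?L \<longleftrightarrow> ?R")
  proof
    assume ?L
    then obtain i where
      "?e \<in> {{vertex i 1, vertex i 2}, {vertex i 2, vertex i 3}, {vertex i 3, vertex i 1}}"
      unfolding vertex_def by blast
    then have "\<exists>r \<in> columns. \<exists>s \<in> columns. r \<noteq> s \<and> ?e = {vertex i r, vertex i s}"
      unfolding columns_def by (elim insertE emptyE; simp; blast)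
    with p show ?R by (auto simp: doubleton_eq_iff vertex_eq_iff)
  next
    assume ?R
    then have "?e \<in> {{3*a+1, 3*a+2}, {3*a+2, 3*a+3}, {3*a+3, 3*a+1}}"
      using p unfolding vertex_def columns_def by (elim insertE emptyE; simp add: insert_commute)
    with a show ?L by blast
  qed
  \<comment> \<open>The bound \<open>j \<le> 3*n - 3\<close> on the lower endpoint says exactly that
    a layer above it exists.\<close>
  have range: "1 \<le> vertex a p \<and> vertex a p \<le> 3*n - 3 \<longleftrightarrow> Suc a < n"
    "1 \<le> vertex b q \<and> vertex b q \<le> 3*n - 3 \<longleftrightarrow> Suc b < n"
    using p by (auto simp: vertex_def columns_def)
  have up: "vertex c r + 3 = vertex (Suc c) r" for c r
    by (simp add: vertex_def)
  have "(\<exists>j. ?e = {j, j+3} \<and> 1 \<le> j \<and> j \<le> 3*n - 3) \<longleftrightarrow>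
     vertex b q = vertex (Suc a) p \<and> Suc a < n \<or> vertex a p = vertex (Suc b) q \<and> Suc b < n"
    unfolding range[symmetric] up[symmetric] doubleton_eq_iff by blast
  also have "\<dots> \<longleftrightarrow> p = q \<and> (b = Suc a \<or> a = Suc b)"
    using a p by (auto simp: vertex_eq_iff)
  finally have up_edge: "(\<exists>j. ?e = {j, j+3} \<and> 1 \<le> j \<and> j \<le> 3*n - 3) \<longleftrightarrow>
      p = q \<and> (b = Suc a \<or> a = Suc b)" .
  have "?e \<in> edges (prism_graph n) \<longleftrightarrow>
      (\<exists>i<n. ?e \<in> {{3*i+1, 3*i+2}, {3*i+2, 3*i+3}, {3*i+3, 3*i+1}}) \<or>
      (\<exists>j. ?e = {j, j+3} \<and> 1 \<le> j \<and> j \<le> 3*n - 3)"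
    unfolding prism_graph_def ugraph.simps Un_iff UN_iff mem_Collect_eq Bex_def lessThan_iff ..
  then show ?thesis
    unfolding tri up_edge .
qed

lemma prism_vertex_cases:
  assumes "x \<in> verts (prism_graph n)"
  obtains a p where "a < n" "p \<in> columns" "x = vertex a p"
proof (rule that)
  have x: "1 \<le> x" "x \<le> 3 * n"
    using assms by (auto simp: prism_graph_def)
  show "(x - 1) div 3 < n" using x by linarith
  show "(x - 1) mod 3 + 1 \<in> columns" by (auto simp: columns_def)
  show "x = vertex ((x - 1) div 3) ((x - 1) mod 3 + 1)"
    unfolding vertex_def using x by presburger
qed

lemma prism_edge_verts:
  assumes "{x, y} \<in> edges (prism_graph n)"
  shows "x \<in> verts (prism_graph n)" "y \<in> verts (prism_graph n)"
  using simple_graph_prism_graph[of n] assms unfolding simple_graph_def by blast+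

lemma ex_other_column: "\<exists>q \<in> columns. q \<noteq> p"
  unfolding columns_def by (cases "p = 1") auto

section \<open>Gallai indices read off from paths with nonadjacent ends\<close>

lemma gallai_indices_eq:
  "gallai_indices G =
     {{i, j, k} | i j k. {i, j} \<in> edges G \<and> {j, k} \<in> edges G \<and> i \<noteq> k \<and> {i, k} \<notin> edges G}
     \<union> {{i, j} | i j. isolated_vertex (gallai_graph G) {i, j}}"
proof -
  have "(\<exists>i j k. F = {i, j, k} \<and> {{i, j}, {j, k}} \<in> edges (gallai_graph G)) \<longleftrightarrow>
     (\<exists>i j k. F = {i, j, k} \<and> {i, j} \<in> edges G \<and> {j, k} \<in> edges G \<and> i \<noteq> k \<and> {i, k} \<notin> edges G)"
    (is "?L = ?R") for F
  proof
    assume ?L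
    then obtain i j k i' j' k' where F: "F = {i, j, k}"
      and eq: "{{i, j}, {j, k}} = {{i', j'}, {j', k'}}"
      and e: "{i', j'} \<in> edges G" "{j', k'} \<in> edges G" "i' \<noteq> k'" "{i', k'} \<notin> edges G"
      unfolding gallai_graph_def by auto
    \<comment> \<open>An edge of the Gallai graph is an unordered pair of edges, so its witnesses
      \<open>i'\<close>, \<open>j'\<close>, \<open>k'\<close> may differ from \<open>i\<close>,
      \<open>j\<close>, \<open>k\<close>. The union of the pair does not depend on the
      representation.\<close>
    have "F = \<Union>{{i, j}, {j, k}}" using F by auto
    then have "F = {i', j', k'}" unfolding eq by auto
    with e show ?R by blast
  next
    assume ?R
    then show ?L unfolding gallai_graph_def ugraph.simps by blast
  qed
  then show ?thesis by (auto simp: gallai_indices_def)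
qed

section \<open>Base faces, facets and their finite verification\<close>

definition translate :: "nat \<Rightarrow> nat set \<Rightarrow> nat set" where
  "translate i A = (+) (3 * i) ` A"

text \<open>\<open>faces1\<close>, \<open>faces2\<close> and \<open>faces3\<close> are the base faces spanning one, two and three layers.\<close>

definition faces1 :: "nat set set" where
  "faces1 = {{1}, {2}, {3}, {1, 2}, {1, 3}, {2, 3}}"

definition faces2 :: "nat set set" where
  "faces2 = {{1, 4}, {2, 5}, {3, 6}, {1, 5}, {1, 6}, {2, 4}, {2, 6}, {3, 4}, {3, 5},
     {1, 2, 4}, {1, 3, 4}, {1, 2, 5}, {2, 3, 5}, {1, 3, 6}, {2, 3, 6},
     {1, 4, 5}, {1, 4, 6}, {2, 4, 5}, {2, 5, 6}, {3, 4, 6}, {3, 5, 6}}"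

definition faces3 :: "nat set set" where
  "faces3 = {{1, 7}, {2, 8}, {3, 9}, {1, 4, 7}, {2, 5, 8}, {3, 6, 9}}"

abbreviation "bases \<equiv> faces1 \<union> faces2 \<union> faces3"

text \<open>A base face starts in layer 0, so the minimum of a translate reveals the shift. This is
  what makes the decomposition into translates unique.\<close>

lemma bases_Min: "\<forall>A \<in> bases. A \<noteq> {} \<and> Min A \<in> {1, 2, 3}"
  by code_simp

lemma bases_disjoint: "faces1 \<inter> faces2 = {}" "faces1 \<inter> faces3 = {}" "faces2 \<inter> faces3 = {}"
  by code_simp+

lemma sum_faces: "(\<Sum>A \<in> faces1. (- 1 :: int) ^ (card A - 1)) = 0"
  "(\<Sum>A \<in> faces2. (- 1 :: int) ^ (card A - 1)) = 3"
  "(\<Sum>A \<in> faces3. (- 1 :: int) ^ (card A - 1)) = 0"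
  by code_simp+

text \<open>Generators come only from two and three layers, since a path inside one triangle has
  adjacent ends.\<close>

definition facets2 :: "nat set set" where
  "facets2 = {F \<in> faces2. card F = 3}"

definition facets3 :: "nat set set" where
  "facets3 = {F \<in> faces3. card F = 3}"

text \<open>These are the L-shaped paths, with the bend in the lower or in the upper layer. Each is
  listed in path order, the bend in the middle.\<close>

lemma facets2_eq:
  "facets2 = (\<Union>p \<in> columns. \<Union>q \<in> columns - {p}.
     {{vertex 0 q, vertex 0 p, vertex 1 p}, {vertex 0 p, vertex 1 p, vertex 1 q}})"
  by code_simp

lemma facets3_eq: "facets3 = (\<Union>p \<in> columns. {{vertex 0 p, vertex 1 p, vertex 2 p}})"
  by code_simp

text \<open>A subset that misses the bottom layer of its facet is a shifted base face; this is where
  the shifts by 1 and 2 come from.\<close>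

lemma facets_subsets:
  "\<forall>A \<in> facets2. \<forall>F \<in> Pow A. F = {} \<or> F \<in> faces1 \<or> F \<in> translate 1 ` faces1 \<or> F \<in> faces2"
  "\<forall>A \<in> facets3. \<forall>F \<in> Pow A. F = {} \<or>
     F \<in> (\<Union>i\<in>{0,1,2}. translate i ` faces1) \<or> F \<in> faces2 \<or> F \<in> translate 1 ` faces2 \<or> F \<in> faces3"
  by code_simp+

text \<open>The shifted version for \<open>faces1\<close> serves the top layer of the prism, where
  no facet can begin: its faces lie in the upper half of a two-layer facet.\<close>

lemma faces_in_facets:
  "\<forall>F \<in> faces1. \<exists>A \<in> facets2. F \<subseteq> A"
  "\<forall>F \<in> translate 1 ` faces1. \<exists>A \<in> facets2. F \<subseteq> A"
  "\<forall>F \<in> faces2. \<exists>A \<in> facets2. F \<subseteq> A"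
  "\<forall>F \<in> faces3. \<exists>A \<in> facets3. F \<subseteq> A"
  by code_simp+

section \<open>The Gallai indices of the prism\<close>

lemma no_isolated_edge_prism:
  assumes n: "n \<ge> 2"
  shows "\<not> isolated_vertex (gallai_graph (prism_graph n)) e"
proof
  assume iso: "isolated_vertex (gallai_graph (prism_graph n)) e"
  let ?E = "edges (prism_graph n)"
  have "e \<in> ?E"
    using iso by (simp add: isolated_vertex_def gallai_graph_def)
  moreover from this obtain x y where "e = {x, y}"
    using simple_graph_prism_graph[of n] unfolding simple_graph_def by (metis card_2_iff)
  ultimately have e: "{x, y} \<in> ?E" "e = {x, y}" by auto
  obtain a p where x: "a < n" "p \<in> columns" "x = vertex a p"
    using prism_edge_verts(1)[OF e(1)] by (rule prism_vertex_cases)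
  obtain b q where y: "b < n" "q \<in> columns" "y = vertex b q"
    using prism_edge_verts(2)[OF e(1)] by (rule prism_vertex_cases)
  have "a = b \<and> p \<noteq> q \<or> p = q \<and> a \<noteq> b"
    using e(1) x y by (auto simp: prism_edge_iff)
  \<comment> \<open>Continue the edge from \<open>y\<close> in the other direction: vertically after
    a step inside a triangle, horizontally after a vertical step. The new vertex differs from
    \<open>x\<close> in both coordinates, hence is neither equal nor adjacent to it.\<close>
  then obtain c r where z: "c < n" "r \<in> columns"
    "{y, vertex c r} \<in> ?E" "x \<noteq> vertex c r" "{x, vertex c r} \<notin> ?E"
  proof (elim disjE conjE)
    assume ab: "a = b" "p \<noteq> q"
    \<comment> \<open>The vertical neighbour is taken below \<open>y\<close>, except in layer 0,
      where \<open>n \<ge> 2\<close> provides layer 1.\<close>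
    obtain c where "c < n" "c = Suc b \<or> b = Suc c"
    proof (cases b)
      case 0
      with n show ?thesis by (intro that[of 1]) auto
    next
      case (Suc c)
      with y(1) show ?thesis by (intro that[of c]) auto
    qed
    with ab x y show thesis
      by (intro that[of c q]) (auto simp: prism_edge_iff vertex_eq_iff)
  next
    assume ab: "p = q" "a \<noteq> b"
    obtain r where "r \<in> columns" "r \<noteq> q"
      using ex_other_column by blast
    with ab x y show thesis
      by (intro that[of b r]) (auto simp: prism_edge_iff vertex_eq_iff)
  qed
  have "{{x, y}, {y, vertex c r}} \<in> edges (gallai_graph (prism_graph n))"
    unfolding gallai_graph_def ugraph.simps using e z by blast
  with iso e show False by (auto simp: isolated_vertex_def)
qed

lemma translate_vertex: "translate i (insert (vertex a p) A) = insert (vertex (i + a) p) (translate i A)"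
  by (simp add: translate_def vertex_def add_mult_distrib2 add.assoc)

lemma translate_empty: "translate i {} = {}"
  by (simp add: translate_def)

text \<open>A path with distinct nonadjacent ends cannot take two horizontal steps, as these stay in
  one triangle. One horizontal and one vertical step give an L (\<open>mixed\<close>); two vertical
  steps give three vertices of one column (\<open>straight\<close>).\<close>

lemma gallai_indices_prism:
  assumes n: "n \<ge> 2"
  shows "gallai_indices (prism_graph n) =
    (\<Union>i<n - 1. translate i ` facets2) \<union> (\<Union>i<n - 2. translate i ` facets3)" (is "_ = ?R")
proof -
  let ?E = "edges (prism_graph n)"
  let ?P = "{{x, y, z} | x y z. {x, y} \<in> ?E \<and> {y, z} \<in> ?E \<and> x \<noteq> z \<and> {x, z} \<notin> ?E}"
  have mixed: "{vertex i q, vertex i p, vertex (Suc i) p} \<in> ?R"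
    "{vertex i p, vertex (Suc i) p, vertex (Suc i) q} \<in> ?R"
    if "Suc i < n" "p \<in> columns" "q \<in> columns" "q \<noteq> p" for i p q
  proof -
    have "{vertex 0 q, vertex 0 p, vertex 1 p} \<in> facets2" "{vertex 0 p, vertex 1 p, vertex 1 q} \<in> facets2"
      unfolding facets2_eq using that by blast+
    moreover have "i \<in> {..<n - 1}" using that by simp
    ultimately have "translate i {vertex 0 q, vertex 0 p, vertex 1 p} \<in> ?R"
      "translate i {vertex 0 p, vertex 1 p, vertex 1 q} \<in> ?R"
      by blast+
    then show "{vertex i q, vertex i p, vertex (Suc i) p} \<in> ?R"
      "{vertex i p, vertex (Suc i) p, vertex (Suc i) q} \<in> ?R"
      by (simp_all only: translate_vertex translate_empty) simp_all
  qed
  have straight: "{vertex i p, vertex (Suc i) p, vertex (Suc (Suc i)) p} \<in> ?R"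
    if "Suc (Suc i) < n" "p \<in> columns" for i p
  proof -
    have "{vertex 0 p, vertex 1 p, vertex 2 p} \<in> facets3"
      unfolding facets3_eq using that by blast
    moreover have "i \<in> {..<n - 2}" using that by simp
    ultimately have "translate i {vertex 0 p, vertex 1 p, vertex 2 p} \<in> ?R" by blast
    then show ?thesis
      by (simp only: translate_vertex translate_empty) simp
  qed
  have "?P \<subseteq> ?R"
  proof
    fix F assume "F \<in> ?P"
    then obtain x y z where F: "F = {x, y, z}" and xy: "{x, y} \<in> ?E" and yz: "{y, z} \<in> ?E"
      and xz: "x \<noteq> z" "{x, z} \<notin> ?E"
      by blast
    obtain a p where x: "a < n" "p \<in> columns" "x = vertex a p"
      using prism_edge_verts(1)[OF xy] by (rule prism_vertex_cases)
    obtain b q where y: "b < n" "q \<in> columns" "y = vertex b q"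
      using prism_edge_verts(2)[OF xy] by (rule prism_vertex_cases)
    obtain c r where z: "c < n" "r \<in> columns" "z = vertex c r"
      using prism_edge_verts(2)[OF yz] by (rule prism_vertex_cases)
    have "a = b \<and> p \<noteq> q \<or> p = q \<and> (b = Suc a \<or> a = Suc b)"
      "b = c \<and> q \<noteq> r \<or> q = r \<and> (c = Suc b \<or> b = Suc c)"
      "\<not> (a = c \<and> p \<noteq> r)" "\<not> (a = c \<and> p = r)"
      using xy yz xz x y z by (auto simp: prism_edge_iff)
    \<comment> \<open>Two vertical steps must go the same way, since otherwise \<open>x = z\<close>.
      Each of the three shapes (horizontal first, vertical first, both vertical) can go up or down,
      which makes six cases; cases 2, 3 and 6 descend and are reordered from the bottom layer
      upwards.\<close>
    then consider "a = b" "q \<noteq> p" "r = q" "c = Suc b" | "a = b" "q \<noteq> p" "r = q" "b = Suc c"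
      | "b = c" "q \<noteq> r" "p = q" "a = Suc b" | "b = c" "q \<noteq> r" "p = q" "b = Suc a"
      | "p = q" "q = r" "b = Suc a" "c = Suc b" | "p = q" "q = r" "a = Suc b" "b = Suc c"
      by (elim disjE conjE) (metis nat.inject)+
    then have "{x, y, z} \<in> ?R"
    proof cases
      case 1
      then show ?thesis using mixed(1)[of a q p] x y z by simp
    next
      case 2
      then have "{x, y, z} = {vertex c q, vertex (Suc c) q, vertex (Suc c) p}"
        using x y z by auto
      then show ?thesis using mixed(2)[of c q p] 2 x y z by simp
    next
      case 3
      then have "{x, y, z} = {vertex c r, vertex c q, vertex (Suc c) q}"
        using x y z by auto
      then show ?thesis using mixed(1)[of c q r] 3 x y z by simp
    next
      case 4
      then show ?thesis using mixed(2)[of a q r] x y z by simp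
    next
      case 5
      then show ?thesis using straight[of a p] x y z by simp
    next
      case 6
      then have "{x, y, z} = {vertex c p, vertex (Suc c) p, vertex (Suc (Suc c)) p}"
        using x y z by auto
      then show ?thesis using straight[of c p] 6 x y z by simp
    qed
    then show "F \<in> ?R" unfolding F .
  qed
  moreover have "?R \<subseteq> ?P"
  proof
    fix F assume F: "F \<in> ?R"
    have path: "F \<in> ?P" if "F = {x, y, z}" "{x, y} \<in> ?E" "{y, z} \<in> ?E" "x \<noteq> z" "{x, z} \<notin> ?E" for x y z
      using that by blast
    from F consider i A where "i < n - 1" "A \<in> facets2" "F = translate i A"
      | i A where "i < n - 2" "A \<in> facets3" "F = translate i A"
      by blast
    then show "F \<in> ?P"
    proof cases
      case (1 i A)
      from 1(2) obtain p q where pq: "p \<in> columns" "q \<in> columns" "q \<noteq> p"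
        and A: "A = {vertex 0 q, vertex 0 p, vertex 1 p} \<or> A = {vertex 0 p, vertex 1 p, vertex 1 q}"
        unfolding facets2_eq by blast
      have i: "i < n" "Suc i < n" using 1 by auto
      from A show ?thesis
      proof
        assume "A = {vertex 0 q, vertex 0 p, vertex 1 p}"
        then have "F = {vertex i q, vertex i p, vertex (Suc i) p}"
          using 1(3) by (simp only: translate_vertex translate_empty) simp
        then show ?thesis
          by (rule path) (use pq i in \<open>simp_all add: prism_edge_iff vertex_eq_iff\<close>)
      next
        assume "A = {vertex 0 p, vertex 1 p, vertex 1 q}"
        then have "F = {vertex i p, vertex (Suc i) p, vertex (Suc i) q}"
          using 1(3) by (simp only: translate_vertex translate_empty) simp
        then show ?thesis
          by (rule path) (use pq i in \<open>simp_all add: prism_edge_iff vertex_eq_iff\<close>)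
      qed
    next
      case (2 i A)
      from 2(2) obtain p where p: "p \<in> columns" and A: "A = {vertex 0 p, vertex 1 p, vertex 2 p}"
        unfolding facets3_eq by blast
      have i: "i < n" "Suc i < n" "Suc (Suc i) < n" using 2 by auto
      have "F = {vertex i p, vertex (Suc i) p, vertex (Suc (Suc i)) p}"
        using 2(3) A by (simp only: translate_vertex translate_empty) simp
      then show ?thesis
        by (rule path) (use p i in \<open>simp_all add: prism_edge_iff vertex_eq_iff\<close>)
    qed
  qed
  ultimately have "?P = ?R" by (rule equalityI)
  then show ?thesis
    unfolding gallai_indices_eq using no_isolated_edge_prism[OF n] by simp
qed

section \<open>The nonempty faces of the complex\<close>

lemma translate_translate: "translate i (translate j A) = translate (i + j) A"
  by (auto simp: translate_def image_image algebra_simps)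

lemma subset_translate_iff: "F \<subseteq> translate i A \<longleftrightarrow> (\<exists>B \<subseteq> A. F = translate i B)"
  by (auto simp: translate_def subset_image_iff)

lemma bases_nonempty: "A \<in> bases \<Longrightarrow> A \<noteq> {}"
  using bases_Min by blast

text \<open>The bounds count the positions where one, two or three consecutive layers fit. Closure
  under subsets and containment in a facet reduce to the finite checks on base faces.\<close>

lemma gallai_complex_prism:
  assumes n: "n \<ge> 2"
  shows "gallai_complex (prism_graph n) - {{}} =
    (\<Union>i<n. translate i ` faces1) \<union> (\<Union>i<n - 1. translate i ` faces2) \<union>
    (\<Union>i<n - 2. translate i ` faces3)" (is "?D = ?R")
proof (rule equalityI; rule subsetI)
  fix F assume "F \<in> ?D"
  then obtain A i where iA: "i < n - 1 \<and> A \<in> facets2 \<or> i < n - 2 \<and> A \<in> facets3"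
    and F: "F \<subseteq> translate i A" "F \<noteq> {}"
    unfolding gallai_complex_def generated_complex_def gallai_indices_prism[OF n] by blast
  from F obtain B where B: "B \<subseteq> A" "F = translate i B" "B \<noteq> {}"
    using subset_translate_iff translate_empty by metis
  have R1: "translate k C \<in> ?R" if "k < n" "C \<in> faces1" for k C
    using that by blast
  have R2: "translate k C \<in> ?R" if "k < n - 1" "C \<in> faces2" for k C
    using that by blast
  have R3: "translate k C \<in> ?R" if "k < n - 2" "C \<in> faces3" for k C
    using that by blast
  from iA show "F \<in> ?R"
  proof (elim disjE conjE)
    assume i: "i < n - 1" and A: "A \<in> facets2"
    have "B \<in> faces1 \<or> B \<in> translate 1 ` faces1 \<or> B \<in> faces2"
      using facets_subsets(1) A B by blast
    then show ?thesis
      unfolding B(2)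
    proof (elim disjE imageE)
      fix C assume "B = translate 1 C" "C \<in> faces1"
      then show "translate i B \<in> ?R"
        using R1[of "i + 1" C] i by (simp only: translate_translate)
    qed (use R1[of i B] R2[of i B] i in simp_all)
  next
    assume i: "i < n - 2" and A: "A \<in> facets3"
    have "B \<in> (\<Union>j\<in>{0,1,2}. translate j ` faces1) \<or> B \<in> faces2 \<or> B \<in> translate 1 ` faces2 \<or> B \<in> faces3"
      using facets_subsets(2) A B by blast
    then show ?thesis
      unfolding B(2)
    proof (elim disjE imageE UN_E)
      \<comment> \<open>Here \<open>i < n - 2\<close> and \<open>j \<le> 2\<close> give
        \<open>i + j < n\<close>, so the shifted layer still exists.\<close>
      fix j C assume "j \<in> {0, 1, 2}" "B = translate j C" "C \<in> faces1"
      then show "translate i B \<in> ?R"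
        using R1[of "i + j" C] i unfolding \<open>B = translate j C\<close> translate_translate
        by fastforce
    next
      fix C assume "B = translate 1 C" "C \<in> faces2"
      then show "translate i B \<in> ?R"
        using R2[of "i + 1" C] i by (simp only: translate_translate)
    qed (use R2[of i B] R3[of i B] i in simp_all)
  qed
next
  fix F assume "F \<in> ?R"
  then consider (1) i B where "i < n" "B \<in> faces1" "F = translate i B"
    | (2) i B where "i < n - 1" "B \<in> faces2" "F = translate i B"
    | (3) i B where "i < n - 2" "B \<in> faces3" "F = translate i B"
    by blast
  then have "\<exists>i B A. F = translate i B \<and> B \<subseteq> A \<and> B \<noteq> {} \<and>
    (i < n - 1 \<and> A \<in> facets2 \<or> i < n - 2 \<and> A \<in> facets3)"
  proof cases
    case (1 i B)
    have "B \<noteq> {}" using 1(2) bases_nonempty by blast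
    show ?thesis
    \<comment> \<open>For \<open>i = 0\<close> the facet extends upwards, which needs
      \<open>n \<ge> 2\<close>. For \<open>i = Suc j\<close> it begins one layer lower, which also
      covers \<open>i = n - 1\<close>.\<close>
    proof (cases i)
      case 0
      then have "i < n - 1" using n by simp
      moreover obtain A where "A \<in> facets2" "B \<subseteq> A"
        using faces_in_facets(1) 1(2) by blast
      ultimately show ?thesis using 1(3) \<open>B \<noteq> {}\<close> by blast
    next
      case (Suc j)
      then have "F = translate j (translate 1 B)" "j < n - 1"
        using 1 by (simp_all add: translate_translate)
      moreover have "translate 1 B \<noteq> {}"
        using \<open>B \<noteq> {}\<close> by (simp add: translate_def)
      moreover obtain A where "A \<in> facets2" "translate 1 B \<subseteq> A"
        using faces_in_facets(2) 1(2) by blast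
      ultimately show ?thesis by blast
    qed
  next
    case (2 i B)
    then obtain A where "A \<in> facets2" "B \<subseteq> A"
      using faces_in_facets(3) by blast
    moreover have "B \<noteq> {}" using 2(2) bases_nonempty by blast
    ultimately show ?thesis using 2 by blast
  next
    case (3 i B)
    then obtain A where "A \<in> facets3" "B \<subseteq> A"
      using faces_in_facets(4) by blast
    moreover have "B \<noteq> {}" using 3(2) bases_nonempty by blast
    ultimately show ?thesis using 3 by blast
  qed
  then obtain i B A where F: "F = translate i B" and BA: "B \<subseteq> A" "B \<noteq> {}"
    and A: "i < n - 1 \<and> A \<in> facets2 \<or> i < n - 2 \<and> A \<in> facets3"
    by blast
  from A have "translate i A \<in> gallai_indices (prism_graph n)"
    unfolding gallai_indices_prism[OF n] by blast
  moreover have "F \<subseteq> translate i A" "F \<noteq> {}"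
    using F BA by (auto simp: translate_def)
  ultimately show "F \<in> ?D"
    unfolding gallai_complex_def generated_complex_def by blast
qed

section \<open>Uniqueness of the representation and the final count\<close>

lemma inj_on_translate:
  "inj_on (\<lambda>(i, A). translate i A) (UNIV \<times> bases)"
proof (rule inj_onI, clarify)
  fix i j A B
  assume A: "A \<in> bases" and B: "B \<in> bases" and eq: "translate i A = translate j B"
  have fin: "finite X" if "X \<in> bases" for X
    using that by (auto simp: faces1_def faces2_def faces3_def)
  have Min_translate: "Min (translate k X) = 3 * k + Min X" if "X \<in> bases" for k X
    unfolding translate_def using that fin bases_Min
    by (intro mono_Min_commute[symmetric]) (auto intro: monoI)
  \<comment> \<open>Both minima lie in \<open>{1, 2, 3}\<close>, so they are the columns of the same
    number and the shifts agree. Injectivity of the shift then gives \<open>A = B\<close>.\<close>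
  have "3 * i + Min A = 3 * j + Min B"
    using Min_translate A B eq by metis
  moreover have "Min A \<in> {1, 2, 3}" "Min B \<in> {1, 2, 3}"
    using bases_Min A B by blast+
  ultimately have "i = j" by auto
  moreover have "inj ((+) (3 * j))" by simp
  ultimately show "i = j \<and> A = B"
    using eq unfolding translate_def by (simp add: inj_image_eq_iff)
qed

theorem theorem3p4:
  fixes n :: nat
  assumes "n \<ge> 3"
  shows "euler_characteristic (gallai_complex (prism_graph n)) = 3 * (int n - 1)"
proof -
  let ?\<Delta> = "gallai_complex (prism_graph n)"
  let ?K1 = "{..<n} \<times> faces1" and ?K2 = "{..<n - 1} \<times> faces2" and ?K3 = "{..<n - 2} \<times> faces3"
  let ?K = "?K1 \<union> ?K2 \<union> ?K3"
  have fin: "finite faces1" "finite faces2" "finite faces3"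
    by (simp_all add: faces1_def faces2_def faces3_def)
  have \<Delta>: "?\<Delta> - {{}} = (\<lambda>(i, A). translate i A) ` ?K"
    using assms by (simp add: gallai_complex_prism image_Un) (auto simp: image_iff)
  have inj: "inj_on (\<lambda>(i, A). translate i A) ?K"
    by (rule inj_on_subset[OF inj_on_translate]) auto
  have "finite (?\<Delta> - {{}})"
    unfolding \<Delta> using fin by simp
  then have "finite ?\<Delta>" by simp
  moreover have "finite F" if "F \<in> ?\<Delta>" for F
  proof (cases "F = {}")
    case False
    with that have "F \<in> (\<lambda>(i, A). translate i A) ` ?K" using \<Delta> by blast
    then show ?thesis by (auto simp: translate_def faces1_def faces2_def faces3_def)
  qed simp
  ultimately have "euler_characteristic ?\<Delta> = (\<Sum>F \<in> ?\<Delta> - {{}}. (- 1) ^ (card F - 1))"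
    by (rule euler_characteristic_eq_sum)
  \<comment> \<open>Translation preserves cardinality, so the sign depends on the base face alone
    and the sum factors on each product.\<close>
  also have "\<dots> = (\<Sum>(i, A) \<in> ?K. (- 1) ^ (card A - 1))"
    unfolding \<Delta> by (subst sum.reindex[OF inj]) (auto intro!: sum.cong simp: translate_def card_image)
  also have "\<dots> = (\<Sum>(i, A) \<in> ?K1. (- 1) ^ (card A - 1)) + (\<Sum>(i, A) \<in> ?K2. (- 1) ^ (card A - 1))
      + (\<Sum>(i, A) \<in> ?K3. (- 1) ^ (card A - 1))"
    using fin bases_disjoint by (subst sum.union_disjoint; (subst sum.union_disjoint)?; auto)
  also have "\<dots> = int n * 0 + int (n - 1) * 3 + int (n - 2) * 0"
    by (simp only: sum.cartesian_product[symmetric] sum_faces) simp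
  \<comment> \<open>The assumption on \<open>n\<close> turns the truncated \<open>n - 1\<close> into
    the integer \<open>int n - 1\<close>.\<close>
  finally show ?thesis using assms by simp
qed

end
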